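(* Let $G$ be a bipartite graph with $m$ edges and spectral radius $\lambda=\lambda(G)$. Then there exist disjoint vertex sets $X,Y\subseteq V(G)$ such that $$\bigl|E(G)\,\triangle\,E(K_{X,Y})\bigr|\le3\bigl(m-\lambda^2\bigr).$$ Moreover, if $m\ge1$, then $X$ and $Y$ can be taken to be $N(v)$ and $N(u)$ for a suitable edge $uv$ of $G$.
   Context: Graphs are finite and simple. The spectral radius is that of the adjacency matrix. For disjoint (possibly empty) vertex sets $X,Y$, $K_{X,Y}$ is the complete bipartite graph with parts $X$ and $Y$, so $E(K_{X,Y})=\{xy: x\in X,\ y\in Y\}$. $\triangle$ denotes symmetric difference of sets, and $N(v)$ is the neighborhood of $v$ in $G$. *)

theory Defs
  imports
    "HOL-Library.Ramsey"
    "Jordan_Normal_Form.Spectral_Radius"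
begin

text \<open>A graph is a vertex set \<open>V\<close> with a set \<open>E\<close> of edges, each edge being the two-element
  set of its end vertices. The null graph (\<open>V = {}\<close>) is allowed.\<close>

definition simple_graph :: "'a set \<Rightarrow> 'a set set \<Rightarrow> bool" where
  "simple_graph V E \<longleftrightarrow> finite V \<and> E \<subseteq> nsets V 2"

definition neighborhood :: "'a set set \<Rightarrow> 'a \<Rightarrow> 'a set" where
  "neighborhood E v = {w. {v, w} \<in> E}"

definition complete_bipartite_edges :: "'a set \<Rightarrow> 'a set \<Rightarrow> 'a set set" where
  "complete_bipartite_edges X Y = {{x, y} |x y. x \<in> X \<and> y \<in> Y}"

definition bipartite :: "'a set \<Rightarrow> 'a set set \<Rightarrow> bool" where
  "bipartite V E \<longleftrightarrow>
     (\<exists>A B. A \<union> B = V \<and> A \<inter> B = {} \<and> E \<subseteq> complete_bipartite_edges A B)"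

definition adjacency_mat :: "'a list \<Rightarrow> 'a set set \<Rightarrow> complex mat" where
  "adjacency_mat vs E =
     mat (length vs) (length vs) (\<lambda>(i, j). if {vs ! i, vs ! j} \<in> E then 1 else 0)"

text \<open>The adjacency matrix depends on the order in which the vertices are listed, but its
  spectral radius does not (\<open>graph_spectral_radius_eq\<close> below), so an arbitrary order is chosen.
  The null graph has no eigenvalues, and \<open>spectral_radius\<close> is unspecified for its matrix;
  its spectral radius is taken to be \<open>0\<close>.\<close>

definition graph_spectral_radius :: "'a set \<Rightarrow> 'a set set \<Rightarrow> real" where
  "graph_spectral_radius V E =
     (if V = {} then 0
      else spectral_radius (adjacency_mat (SOME vs. distinct vs \<and> set vs = V) E))"

lemma eigenvalue_adjacency_mat:
  assumes "distinct vs"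
  shows "eigenvalue (adjacency_mat vs E) k \<longleftrightarrow>
    (\<exists>f. (\<exists>v\<in>set vs. f v \<noteq> 0) \<and>
         (\<forall>v\<in>set vs. (\<Sum>w\<in>set vs. if {v, w} \<in> E then f w else 0) = k * f v))"
    (is "_ \<longleftrightarrow> (\<exists>f. ?P f)")
proof -
  let ?n = "length vs"
  let ?A = "adjacency_mat vs E"
  have dim: "dim_row ?A = ?n" "dim_col ?A = ?n"
    by (auto simp: adjacency_mat_def)
  have reindex: "(\<Sum>w\<in>set vs. g w) = (\<Sum>j<?n. g (vs ! j))" for g :: "'a \<Rightarrow> complex"
  proof -
    have "bij_betw ((!) vs) {..<?n} (set vs)"
      using assms by (intro bij_betw_nth) auto
    from sum.reindex_bij_betw[OF this, of g] show ?thesis by simp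
  qed
  have Ax: "(?A *\<^sub>v x) $ i = (\<Sum>j<?n. if {vs ! i, vs ! j} \<in> E then x $ j else 0)"
    if "x \<in> carrier_vec ?n" "i < ?n" for x i
    using that
    by (auto simp: adjacency_mat_def scalar_prod_def lessThan_atLeast0 intro!: sum.cong)
  have key: "eigenvector ?A x k \<longleftrightarrow> ?P f"
    if x: "x \<in> carrier_vec ?n" and f: "\<And>i. i < ?n \<Longrightarrow> f (vs ! i) = x $ i" for x f
  proof -
    have "x \<noteq> 0\<^sub>v ?n \<longleftrightarrow> (\<exists>v\<in>set vs. f v \<noteq> 0)"
    proof
      assume "x \<noteq> 0\<^sub>v ?n"
      then obtain i where "i < ?n" "x $ i \<noteq> 0"
        using x by (metis carrier_vecD eq_vecI index_zero_vec)
      then show "\<exists>v\<in>set vs. f v \<noteq> 0" using f by (metis nth_mem)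
    next
      assume "\<exists>v\<in>set vs. f v \<noteq> 0"
      then show "x \<noteq> 0\<^sub>v ?n" using f by (metis in_set_conv_nth index_zero_vec(1))
    qed
    moreover have "?A *\<^sub>v x = k \<cdot>\<^sub>v x \<longleftrightarrow> (\<forall>i<?n. (?A *\<^sub>v x) $ i = k * x $ i)"
      using x dim by (auto simp: vec_eq_iff)
    moreover have "(?A *\<^sub>v x) $ i
        = (\<Sum>w\<in>set vs. if {vs ! i, w} \<in> E then f w else 0)" if "i < ?n" for i
      unfolding Ax[OF x that] reindex using f by (intro sum.cong) auto
    ultimately show ?thesis
      unfolding eigenvector_def dim all_set_conv_all_nth using x f by simp
  qed
  show ?thesis
  proof
    assume "eigenvalue ?A k"
    then obtain x where ev: "eigenvector ?A x k" by (auto simp: eigenvalue_def)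
    then have x: "x \<in> carrier_vec ?n" by (simp add: eigenvector_def dim)
    define f where "f v = x $ (THE i. i < ?n \<and> vs ! i = v)" for v
    have "f (vs ! i) = x $ i" if "i < ?n" for i
    proof -
      have "(THE j. j < ?n \<and> vs ! j = vs ! i) = i"
        using that assms by (intro the_equality) (auto simp: nth_eq_iff_index_eq)
      then show ?thesis by (simp add: f_def)
    qed
    from key[OF x this] ev show "\<exists>f. ?P f" by blast
  next
    assume "\<exists>f. ?P f"
    then obtain f where "?P f" ..
    moreover have "vec ?n (\<lambda>i. f (vs ! i)) \<in> carrier_vec ?n" by simp
    ultimately have "eigenvector ?A (vec ?n (\<lambda>i. f (vs ! i))) k"
      using key[of "vec ?n (\<lambda>i. f (vs ! i))" f] by simp
    then show "eigenvalue ?A k" by (auto simp: eigenvalue_def)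
  qed
qed

lemma graph_spectral_radius_eq:
  assumes "distinct vs" "set vs = V" "V \<noteq> {}"
  shows "graph_spectral_radius V E = spectral_radius (adjacency_mat vs E)"
proof -
  define us where "us = (SOME us. distinct us \<and> set us = V)"
  have "distinct us \<and> set us = V"
    unfolding us_def by (rule someI[of _ vs]) (use assms in auto)
  then have "eigenvalue (adjacency_mat us E) k = eigenvalue (adjacency_mat vs E) k" for k
    using assms by (simp add: eigenvalue_adjacency_mat)
  then have "spectrum (adjacency_mat us E) = spectrum (adjacency_mat vs E)"
    by (simp add: spectrum_def set_eq_iff)
  then show ?thesis
    using assms by (simp add: graph_spectral_radius_def us_def spectral_radius_def)
qed

end

theory Submission
  imports Defs "HOL-Analysis.Convex"
begin

text \<open>
  Let \<open>M\<close> be the biadjacency matrix of \<open>G\<close>, with parts \<open>A\<close> and \<open>B\<close>. An edge \<open>uv\<close> is chosen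
  uniformly at random. The size of \<open>E \<triangle> E(K\<^bsub>N(v),N(u)\<^esub>)\<close> is the number of entries at which
  \<open>M\<close> differs from the rank one matrix \<open>(M\<^bsub>av\<^esub> M\<^bsub>ub\<^esub>)\<^bsub>ab\<^esub>\<close>. Its sum over all edges \<open>uv\<close> counts
  the \<open>2 \<times> 2\<close> submatrices whose diagonal is \<open>1, 1\<close> and whose antidiagonal is not, and those
  whose only zero is at \<open>ab\<close>. There are \<open>P = m\<^sup>2 - tr (M M\<^sup>T)\<^sup>2\<close> of the first kind. By symmetry
  those of the second kind are at most \<open>P / 2\<close>. As \<open>\<lambda>\<^sup>2\<close> is an eigenvalue of \<open>M M\<^sup>T\<close>,
  \<open>P \<le> m\<^sup>2 - \<lambda>\<^sup>4 \<le> 2 m (m - \<lambda>\<^sup>2)\<close>, so the average is at most \<open>3 (m - \<lambda>\<^sup>2)\<close>.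
\<close>

section \<open>Eigenvalues and the Frobenius norm\<close>

text \<open>Cauchy-Schwarz in each row of the eigenvalue equation, summed over the rows; the squared
  norm \<open>F\<close> of the eigenvector then cancels.\<close>

lemma eigenvalue_le_frobenius_norm:
  fixes C :: "'a \<Rightarrow> 'a \<Rightarrow> real" and f :: "'a \<Rightarrow> complex" and k :: complex
  assumes "finite A" and ev: "\<And>a. a \<in> A \<Longrightarrow> (\<Sum>b\<in>A. of_real (C a b) * f b) = k * f a"
    and nz: "\<exists>a\<in>A. f a \<noteq> 0"
  shows "(cmod k)\<^sup>2 \<le> (\<Sum>a\<in>A. \<Sum>b\<in>A. (C a b)\<^sup>2)"
proof -
  define F where "F = (\<Sum>a\<in>A. (cmod (f a))\<^sup>2)"
  have F: "F > 0"
    using nz assms(1) unfolding F_def by (auto intro!: sum_pos2)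
  have row: "(cmod k)\<^sup>2 * (cmod (f a))\<^sup>2 \<le> (\<Sum>b\<in>A. (C a b)\<^sup>2) * F" if "a \<in> A" for a
  proof -
    have "cmod k * cmod (f a) \<le> (\<Sum>b\<in>A. \<bar>C a b\<bar> * cmod (f b))"
      using norm_sum[of "\<lambda>b. of_real (C a b) * f b" A] ev[OF that] by (simp add: norm_mult)
    then have "(cmod k * cmod (f a))\<^sup>2 \<le> (\<Sum>b\<in>A. \<bar>C a b\<bar> * cmod (f b))\<^sup>2"
      by (intro power_mono) auto
    also have "\<dots> \<le> (\<Sum>b\<in>A. \<bar>C a b\<bar>\<^sup>2) * (\<Sum>b\<in>A. (cmod (f b))\<^sup>2)"
      by (rule Cauchy_Schwarz_ineq_sum)
    finally show ?thesis by (simp add: F_def power_mult_distrib)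
  qed
  have "(cmod k)\<^sup>2 * F = (\<Sum>a\<in>A. (cmod k)\<^sup>2 * (cmod (f a))\<^sup>2)"
    by (simp add: F_def sum_distrib_left)
  also have "\<dots> \<le> (\<Sum>a\<in>A. (\<Sum>b\<in>A. (C a b)\<^sup>2) * F)"
    by (rule sum_mono[OF row])
  also have "\<dots> = (\<Sum>a\<in>A. \<Sum>b\<in>A. (C a b)\<^sup>2) * F"
    by (simp add: sum_distrib_right)
  finally have "(cmod k)\<^sup>2 * F \<le> (\<Sum>a\<in>A. \<Sum>b\<in>A. (C a b)\<^sup>2) * F" .
  with F show ?thesis by simp
qed

section \<open>Counting in 0/1 matrices\<close>

text \<open>This is the trace of \<open>(M M^T)^2\<close>, which is also the squared Frobenius norm
  of \<open>M M^T\<close>. For a 0/1 matrix it counts the all-one 2 x 2 submatrices, including the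
  degenerate ones with \<open>u = a\<close> or \<open>v = b\<close>.\<close>

definition four_cycles :: "('a \<Rightarrow> 'b \<Rightarrow> real) \<Rightarrow> 'a set \<Rightarrow> 'b set \<Rightarrow> real" where
  "four_cycles M A B = (\<Sum>u\<in>A. \<Sum>a\<in>A. \<Sum>v\<in>B. \<Sum>b\<in>B. M u v * M a v * M u b * M a b)"

lemma four_cycles_eq:
  "four_cycles M A B = (\<Sum>u\<in>A. \<Sum>a\<in>A. (\<Sum>b\<in>B. M u b * M a b)\<^sup>2)"
  by (simp add: four_cycles_def power2_eq_square sum_product mult_ac)

lemma sum_rank_one_defect_le:
  fixes M :: "'a \<Rightarrow> 'b \<Rightarrow> real" and A :: "'a set" and B :: "'b set"
  assumes M: "\<And>a b. M a b = 0 \<or> M a b = 1"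
  defines "S \<equiv> (\<Sum>a\<in>A. \<Sum>b\<in>B. M a b)"
  shows "2 * (\<Sum>u\<in>A. \<Sum>v\<in>B. M u v * (\<Sum>a\<in>A. \<Sum>b\<in>B. \<bar>M a b - M a v * M u b\<bar>))
    \<le> 3 * (S\<^sup>2 - four_cycles M A B)"
proof -
  define sum4 where "sum4 g = (\<Sum>u\<in>A. \<Sum>a\<in>A. \<Sum>v\<in>B. \<Sum>b\<in>B. g u a v b)"
    for g :: "'a \<Rightarrow> 'a \<Rightarrow> 'b \<Rightarrow> 'b \<Rightarrow> real"
  \<comment> \<open>\<open>W\<close> leaves the corner \<open>ab\<close> free. With T for
    \<open>four_cycles M A B\<close>, the submatrices of the first kind number S^2 - T and those of
    the second kind W - T.\<close>
  define W where "W = sum4 (\<lambda>u a v b. M u v * M a v * M u b)"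
  have swap_rows: "sum4 g = sum4 (\<lambda>u a. g a u)" for g
    unfolding sum4_def by (rule sum.swap)
  have swap_cols: "sum4 g = sum4 (\<lambda>u a v b. g u a b v)" for g
    unfolding sum4_def by (intro sum.cong refl sum.swap)
  have add: "sum4 (\<lambda>u a v b. g u a v b + h u a v b) = sum4 g + sum4 h" for g h
    by (simp add: sum4_def sum.distrib)
  have scale: "sum4 (\<lambda>u a v b. c * g u a v b) = c * sum4 g" for c g
    by (simp add: sum4_def sum_distrib_left)
  have mono: "sum4 g \<le> sum4 h" if "\<And>u a v b. g u a v b \<le> h u a v b" for g h
    unfolding sum4_def by (intro sum_mono that)
  have T: "sum4 (\<lambda>u a v b. M u v * M a v * M u b * M a b) = four_cycles M A B"
    by (simp add: sum4_def four_cycles_def)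
  have SS: "sum4 (\<lambda>u a v b. M u v * M a b) = S\<^sup>2"
    by (simp add: sum4_def S_def power2_eq_square sum_product)
  \<comment> \<open>Exchanging the two rows, or the two columns, moves the free corner onto the
    antidiagonal.\<close>
  have "sum4 (\<lambda>u a v b. M u v * M a v * M a b) = W"
    unfolding W_def by (subst swap_rows) (simp add: mult_ac)
  moreover have "sum4 (\<lambda>u a v b. M u v * M u b * M a b) = sum4 (\<lambda>u a v b. M u v * M a v * M u b)"
    by (subst swap_cols) (simp add: mult_ac)
  \<comment> \<open>Pointwise this is
    \<open>M u v * M a b * (1 - M a v) * (1 - M u b) \<ge> 0\<close>, expanded.\<close>
  moreover have "sum4 (\<lambda>u a v b. M u v * M a v * M a b + M u v * M u b * M a b)
      \<le> sum4 (\<lambda>u a v b. M u v * M a b + M u v * M a v * M u b * M a b)"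
  proof (rule mono)
    fix u a v b
    show "M u v * M a v * M a b + M u v * M u b * M a b
        \<le> M u v * M a b + M u v * M a v * M u b * M a b"
      using M[of u v] M[of a v] M[of u b] M[of a b] by auto
  qed
  ultimately have W: "2 * W \<le> S\<^sup>2 + four_cycles M A B"
    unfolding add SS T W_def by linarith
  have "(\<Sum>u\<in>A. \<Sum>v\<in>B. M u v * (\<Sum>a\<in>A. \<Sum>b\<in>B. \<bar>M a b - M a v * M u b\<bar>))
      = (\<Sum>u\<in>A. \<Sum>v\<in>B. \<Sum>a\<in>A. \<Sum>b\<in>B. M u v * \<bar>M a b - M a v * M u b\<bar>)"
    by (simp add: sum_distrib_left)
  also have "\<dots> = sum4 (\<lambda>u a v b. M u v * \<bar>M a b - M a v * M u b\<bar>)"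
    unfolding sum4_def by (intro sum.cong refl sum.swap)
  \<comment> \<open>For x, y in {0, 1}, |x - y| = x + y - 2xy; here x is \<open>M a b\<close> and y
    is \<open>M a v * M u b\<close>.\<close>
  also have "(\<lambda>u a v b. M u v * \<bar>M a b - M a v * M u b\<bar>)
      = (\<lambda>u a v b. (M u v * M a b + M u v * M a v * M u b)
          + (-2) * (M u v * M a v * M u b * M a b))"
  proof (intro ext)
    fix u a v b
    show "M u v * \<bar>M a b - M a v * M u b\<bar>
      = (M u v * M a b + M u v * M a v * M u b) + (-2) * (M u v * M a v * M u b * M a b)"
      using M[of u v] M[of a v] M[of u b] M[of a b] by auto
  qed
  also have "sum4 \<dots> = S\<^sup>2 + W - 2 * four_cycles M A B"
    unfolding add scale SS T W_def by simp
  finally have defect: "(\<Sum>u\<in>A. \<Sum>v\<in>B. M u v * (\<Sum>a\<in>A. \<Sum>b\<in>B. \<bar>M a b - M a v * M u b\<bar>))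
      = S\<^sup>2 + W - 2 * four_cycles M A B" .
  show ?thesis unfolding defect using W by simp
qed

text \<open>Averaging over the one-entries, with \<open>S\<close> in the role of m and
  \<open>l\<close> in that of \<lambda>^2. If every one-entry exceeded the bound, the total defect
  would exceed 3S(S - l), whereas it is at most 3/2 (S - l)(S + l), and S + l is at most 2S.\<close>

lemma exists_rank_one_defect_le:
  fixes M :: "'a \<Rightarrow> 'b \<Rightarrow> real" and A :: "'a set" and B :: "'b set" and l :: real
  assumes M: "\<And>a b. M a b = 0 \<or> M a b = 1"
  defines "S \<equiv> (\<Sum>a\<in>A. \<Sum>b\<in>B. M a b)"
  assumes S: "S > 0" and l: "0 \<le> l" "l \<le> S" "l\<^sup>2 \<le> four_cycles M A B"
  obtains u v where "u \<in> A" "v \<in> B" "M u v = 1"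
    "(\<Sum>a\<in>A. \<Sum>b\<in>B. \<bar>M a b - M a v * M u b\<bar>) \<le> 3 * (S - l)"
proof (rule ccontr)
  define D where "D u v = (\<Sum>a\<in>A. \<Sum>b\<in>B. \<bar>M a b - M a v * M u b\<bar>)" for u v
  assume "\<not> thesis"
  with that have D: "D u v > 3 * (S - l)" if "u \<in> A" "v \<in> B" "M u v = 1" for u v
    using \<open>u \<in> A\<close> \<open>v \<in> B\<close> \<open>M u v = 1\<close> unfolding D_def by force
  have less: "M u v * (3 * (S - l)) < M u v * D u v" if "u \<in> A" "v \<in> B" "M u v \<noteq> 0" for u v
    using D that M[of u v] by auto
  have le: "M u v * (3 * (S - l)) \<le> M u v * D u v" if "u \<in> A" "v \<in> B" for u v
    using less[OF that] by (cases "M u v = 0") auto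
  \<comment> \<open>Sums over infinite sets are 0, so \<open>S > 0\<close> forces finiteness. It
    also provides a nonzero entry, which makes the summed inequality strict.\<close>
  have fin: "finite A"
    using S unfolding S_def by (rule contrapos_pp) simp
  have "\<exists>u\<in>A. (\<Sum>v\<in>B. M u v) \<noteq> 0"
    using S unfolding S_def by (rule contrapos_pp) simp
  then obtain u where u: "u \<in> A" "(\<Sum>v\<in>B. M u v) \<noteq> 0" ..
  have finB: "finite B"
    using u(2) by (rule contrapos_np) simp
  have "\<exists>v\<in>B. M u v \<noteq> 0"
    using u(2) by (rule contrapos_np) simp
  then obtain v where v: "v \<in> B" "M u v \<noteq> 0" ..
  have "S * (3 * (S - l)) = (\<Sum>u\<in>A. \<Sum>v\<in>B. M u v * (3 * (S - l)))"
    by (simp add: S_def sum_distrib_right)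
  also have "\<dots> < (\<Sum>u\<in>A. \<Sum>v\<in>B. M u v * D u v)"
  proof (rule sum_strict_mono_ex1)
    show "\<forall>u\<in>A. (\<Sum>v\<in>B. M u v * (3 * (S - l))) \<le> (\<Sum>v\<in>B. M u v * D u v)"
      by (intro ballI sum_mono le)
    have "(\<Sum>v\<in>B. M u v * (3 * (S - l))) < (\<Sum>v\<in>B. M u v * D u v)"
      by (rule sum_strict_mono_ex1) (use finB u v le less in blast)+
    with u show "\<exists>u\<in>A. (\<Sum>v\<in>B. M u v * (3 * (S - l))) < (\<Sum>v\<in>B. M u v * D u v)"
      by blast
  qed (rule fin)
  finally have "2 * (S * (3 * (S - l))) < 2 * (\<Sum>u\<in>A. \<Sum>v\<in>B. M u v * D u v)" by simp
  also have "\<dots> \<le> 3 * (S\<^sup>2 - four_cycles M A B)"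
    unfolding D_def S_def by (rule sum_rank_one_defect_le[OF M])
  also have "\<dots> \<le> 3 * (S\<^sup>2 - l\<^sup>2)" using l by simp
  also have "\<dots> = 3 * ((S - l) * (S + l))" by (simp add: power2_eq_square algebra_simps)
  also have "\<dots> \<le> 3 * ((S - l) * (2 * S))"
    using l by (intro mult_left_mono) auto
  finally show False by (simp add: mult_ac)
qed

section \<open>Bipartite graphs and their biadjacency matrix\<close>

locale bipartite_graph =
  fixes A B :: "'a set" and E :: "'a set set"
  assumes finite_parts: "finite A" "finite B" and disjoint: "A \<inter> B = {}"
    and edges: "E \<subseteq> complete_bipartite_edges A B"
begin

definition adj :: "'a \<Rightarrow> 'a \<Rightarrow> real" where
  "adj a b = of_bool ({a, b} \<in> E)"

lemma adj_01: "adj a b = 0 \<or> adj a b = 1"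
  by (simp add: adj_def)

lemma edge_cases:
  assumes "{a, b} \<in> E"
  shows "a \<in> A \<and> b \<in> B \<or> a \<in> B \<and> b \<in> A"
  using assms edges by (auto simp: complete_bipartite_edges_def doubleton_eq_iff)

lemma neighborhood_subset:
  shows "a \<in> A \<Longrightarrow> neighborhood E a \<subseteq> B" and "b \<in> B \<Longrightarrow> neighborhood E b \<subseteq> A"
  using edge_cases disjoint by (auto simp: neighborhood_def)

lemma inj_on_edge: "inj_on (\<lambda>(a, b). {a, b}) (A \<times> B)"
  using disjoint by (auto simp: inj_on_def doubleton_eq_iff)

text \<open>As the parts are disjoint, each edge comes from exactly one pair in
  \<open>A \<times> B\<close>.\<close>

lemma card_edge_set:
  assumes "F \<subseteq> complete_bipartite_edges A B"
  shows "real (card F) = (\<Sum>a\<in>A. \<Sum>b\<in>B. of_bool ({a, b} \<in> F))"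
proof -
  let ?P = "{p \<in> A \<times> B. (\<lambda>(a, b). {a, b}) p \<in> F}"
  have "F = (\<lambda>(a, b). {a, b}) ` ?P"
    using assms by (fastforce simp: complete_bipartite_edges_def)
  then have "card F = card ?P"
    using card_image[OF inj_on_subset[OF inj_on_edge, of ?P]]
    by (metis (no_types, lifting) mem_Collect_eq subsetI)
  also have "real \<dots> = (\<Sum>p\<in>A \<times> B. of_bool ((\<lambda>(a, b). {a, b}) p \<in> F))"
    using finite_parts by (simp add: of_bool_def sum.If_cases Int_def)
  finally show ?thesis by (simp add: sum.cartesian_product case_prod_beta)
qed

lemma card_edges: "real (card E) = (\<Sum>a\<in>A. \<Sum>b\<in>B. adj a b)"
  using card_edge_set[OF edges] by (simp add: adj_def)

text \<open>Since N(v) lies in \<open>A\<close> and N(u) in \<open>B\<close>, the pair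
  \<open>ab\<close> is an edge of the complete bipartite graph exactly when
  \<open>adj a v * adj u b\<close> is 1.\<close>

lemma card_sym_diff_neighborhoods:
  assumes "u \<in> A" "v \<in> B"
  shows "real (card (sym_diff E (complete_bipartite_edges (neighborhood E v) (neighborhood E u))))
    = (\<Sum>a\<in>A. \<Sum>b\<in>B. \<bar>adj a b - adj a v * adj u b\<bar>)"
proof -
  let ?K = "complete_bipartite_edges (neighborhood E v) (neighborhood E u)"
  have sub: "neighborhood E v \<subseteq> A" "neighborhood E u \<subseteq> B"
    using neighborhood_subset assms by auto
  then have K: "?K \<subseteq> complete_bipartite_edges A B"
    by (auto simp: complete_bipartite_edges_def)
  have "{a, b} \<in> ?K \<longleftrightarrow> {a, v} \<in> E \<and> {u, b} \<in> E" if "a \<in> A" "b \<in> B" for a b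
    using that sub disjoint
    by (auto simp: complete_bipartite_edges_def doubleton_eq_iff neighborhood_def insert_commute)
  then have "of_bool ({a, b} \<in> sym_diff E ?K) = \<bar>adj a b - adj a v * adj u b\<bar>"
    if "a \<in> A" "b \<in> B" for a b
    using that by (auto simp: adj_def)
  moreover have "sym_diff E ?K \<subseteq> complete_bipartite_edges A B"
    using K edges by blast
  ultimately show ?thesis
    using card_edge_set by simp
qed

text \<open>Together with the spectral bound below, this gives \<lambda>^2 \<le> m.\<close>

lemma four_cycles_le: "four_cycles adj A B \<le> (real (card E))\<^sup>2"
proof -
  have "four_cycles adj A B \<le> (\<Sum>u\<in>A. \<Sum>a\<in>A. \<Sum>v\<in>B. \<Sum>b\<in>B. adj u v * adj a b)"
    unfolding four_cycles_def by (intro sum_mono) (auto simp: adj_def)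
  also have "\<dots> = (real (card E))\<^sup>2"
    by (simp add: card_edges power2_eq_square sum_product)
  finally show ?thesis .
qed

text \<open>The spectral radius is the modulus of some eigenvalue \<open>k\<close>. Going from
  \<open>A\<close> to \<open>B\<close> and back shows that the eigenvector, restricted to
  \<open>A\<close>, satisfies the eigenvalue equation of \<open>M M^T\<close> for
  \<open>k\<^sup>2\<close>, so the Frobenius bound applies.\<close>

lemma spectral_radius_power4_le:
  "graph_spectral_radius (A \<union> B) E ^ 4 \<le> four_cycles adj A B"
proof (cases "A \<union> B = {}")
  case True
  then show ?thesis by (simp add: graph_spectral_radius_def four_cycles_def)
next
  case False
  obtain vs where vs: "distinct vs" "set vs = A \<union> B"
    using finite_distinct_list finite_parts by (metis finite_Un)
  let ?M = "adjacency_mat vs E"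
  have "?M \<in> carrier_mat (length vs) (length vs)" "length vs > 0"
    using vs False by (auto simp: adjacency_mat_def)
  then have "spectral_radius ?M \<in> cmod ` spectrum ?M"
    by (rule spectral_radius_mem_max(1))
  then obtain k where k: "eigenvalue ?M k" "graph_spectral_radius (A \<union> B) E = cmod k"
    using graph_spectral_radius_eq[OF vs False] by (auto simp: spectrum_def)
  then obtain f where nz: "\<exists>v\<in>A \<union> B. f v \<noteq> 0"
    and ev: "\<And>v. v \<in> A \<union> B \<Longrightarrow> (\<Sum>w\<in>A \<union> B. if {v, w} \<in> E then f w else 0) = k * f v"
    unfolding eigenvalue_adjacency_mat[OF vs(1)] vs(2) by blast
  have evA: "(\<Sum>b\<in>B. of_real (adj a b) * f b) = k * f a" if "a \<in> A" for a
  proof -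
    have "(\<Sum>w\<in>A \<union> B. if {a, w} \<in> E then f w else 0) = (\<Sum>b\<in>B. of_real (adj a b) * f b)"
      using finite_parts that edge_cases disjoint
      by (intro sum.mono_neutral_cong_right) (auto simp: adj_def)
    then show ?thesis using ev that by simp
  qed
  have evB: "(\<Sum>a\<in>A. of_real (adj a b) * f a) = k * f b" if "b \<in> B" for b
  proof -
    have "(\<Sum>w\<in>A \<union> B. if {b, w} \<in> E then f w else 0) = (\<Sum>a\<in>A. of_real (adj a b) * f a)"
      using finite_parts that edge_cases disjoint
      by (intro sum.mono_neutral_cong_right) (auto simp: adj_def insert_commute)
    then show ?thesis using ev that by simp
  qed
  have "cmod k ^ 4 \<le> four_cycles adj A B"
  proof (cases "k = 0")
    case True
    then show ?thesis by (simp add: four_cycles_eq sum_nonneg)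
  next
    case False
    \<comment> \<open>An eigenvector that vanishes on \<open>A\<close> would vanish on
      \<open>B\<close> too, as \<open>k\<close> is nonzero.\<close>
    have nzA: "\<exists>a\<in>A. f a \<noteq> 0"
    proof (rule ccontr)
      assume "\<not> ?thesis"
      then have "k * f b = 0" if "b \<in> B" for b
        using evB[OF that] by simp
      with False nz \<open>\<not> ?thesis\<close> show False by auto
    qed
    have "(cmod (k\<^sup>2))\<^sup>2 \<le> (\<Sum>u\<in>A. \<Sum>a\<in>A. (\<Sum>b\<in>B. adj u b * adj a b)\<^sup>2)"
    proof (rule eigenvalue_le_frobenius_norm[OF finite_parts(1) _ nzA])
      fix u assume u: "u \<in> A"
      have "(\<Sum>a\<in>A. of_real (\<Sum>b\<in>B. adj u b * adj a b) * f a)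
          = (\<Sum>b\<in>B. of_real (adj u b) * (\<Sum>a\<in>A. of_real (adj a b) * f a))"
        by (simp add: sum_distrib_left sum_distrib_right mult.assoc) (rule sum.swap)
      also have "\<dots> = (\<Sum>b\<in>B. k * (of_real (adj u b) * f b))"
        by (intro sum.cong) (auto simp: evB)
      also have "\<dots> = k\<^sup>2 * f u"
        by (simp add: evA[OF u] sum_distrib_left[symmetric] power2_eq_square)
      finally show "(\<Sum>a\<in>A. of_real (\<Sum>b\<in>B. adj u b * adj a b) * f a) = k\<^sup>2 * f u" .
    qed
    then show ?thesis by (simp add: four_cycles_eq norm_power)
  qed
  with k(2) show ?thesis by simp
qed

end

theorem lemma4p3:
  fixes V :: "'a set" and E :: "'a set set" and m :: nat and lam :: real
  assumes "simple_graph V E"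
    and "bipartite V E"
    and "m = card E"
    and "lam = graph_spectral_radius V E"
  shows "(\<exists>X Y. X \<subseteq> V \<and> Y \<subseteq> V \<and> X \<inter> Y = {} \<and>
            real (card (sym_diff E (complete_bipartite_edges X Y))) \<le> 3 * (real m - lam\<^sup>2)) \<and>
         (m \<ge> 1 \<longrightarrow>
           (\<exists>u v X Y. {u, v} \<in> E \<and> X = neighborhood E v \<and> Y = neighborhood E u \<and>
              X \<subseteq> V \<and> Y \<subseteq> V \<and> X \<inter> Y = {} \<and>
              real (card (sym_diff E (complete_bipartite_edges X Y))) \<le> 3 * (real m - lam\<^sup>2)))"
proof -
  obtain A B where V: "A \<union> B = V" and AB: "A \<inter> B = {}" "E \<subseteq> complete_bipartite_edges A B"
    using assms(2) by (auto simp: bipartite_def)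
  have "finite V" using assms(1) by (simp add: simple_graph_def)
  then interpret bipartite_graph A B E
    using V AB by unfold_locales auto
  have lam4: "(lam\<^sup>2)\<^sup>2 \<le> four_cycles adj A B"
    using spectral_radius_power4_le assms(4) V by (simp add: power4_eq_xxxx power2_eq_square mult.assoc)
  have lam: "lam\<^sup>2 \<le> real m"
    using order_trans[OF lam4 four_cycles_le] assms(3) by (intro power2_le_imp_le[of "lam\<^sup>2"]) auto
  have main: "\<exists>u v X Y. {u, v} \<in> E \<and> X = neighborhood E v \<and> Y = neighborhood E u \<and>
      X \<subseteq> V \<and> Y \<subseteq> V \<and> X \<inter> Y = {} \<and>
      real (card (sym_diff E (complete_bipartite_edges X Y))) \<le> 3 * (real m - lam\<^sup>2)"
    if "m \<ge> 1"
  proof -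
    have m: "(\<Sum>a\<in>A. \<Sum>b\<in>B. adj a b) = real m"
      using card_edges assms(3) by simp
    obtain u v where uv: "u \<in> A" "v \<in> B" "adj u v = 1"
      and le: "(\<Sum>a\<in>A. \<Sum>b\<in>B. \<bar>adj a b - adj a v * adj u b\<bar>) \<le> 3 * (real m - lam\<^sup>2)"
    proof (rule exists_rank_one_defect_le[where M = adj and A = A and B = B and l = "lam\<^sup>2"])
      show "0 < (\<Sum>a\<in>A. \<Sum>b\<in>B. adj a b)" "lam\<^sup>2 \<le> (\<Sum>a\<in>A. \<Sum>b\<in>B. adj a b)"
        unfolding m using \<open>m \<ge> 1\<close> lam by simp_all
    qed (use adj_01 lam4 in \<open>simp_all only: m zero_le_power2\<close>)
    have edge: "{u, v} \<in> E" using uv(3) by (simp add: adj_def)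
    have parts: "neighborhood E v \<subseteq> A" "neighborhood E u \<subseteq> B"
      using neighborhood_subset uv by auto
    then have sub: "neighborhood E v \<subseteq> V" "neighborhood E u \<subseteq> V"
      "neighborhood E v \<inter> neighborhood E u = {}"
      using V AB(1) by blast+
    show ?thesis
      by (rule exI[of _ u], rule exI[of _ v], rule exI[of _ "neighborhood E v"],
          rule exI[of _ "neighborhood E u"])
        (use edge sub le in \<open>simp only: card_sym_diff_neighborhoods[OF uv(1,2)] simp_thms\<close>)
  qed
  show ?thesis
  proof (cases "m \<ge> 1")
    case True
    with main show ?thesis by blast
  next
    case False
    \<comment> \<open>Without edges, X and Y are both empty, and the bound is nonnegative by
      \<open>lam\<close>. Finiteness excludes an infinite \<open>E\<close>, whose
      \<open>card\<close> would be 0 as well.\<close>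
    have "finite E"
      using finite_subset[OF edges] finite_parts
      by (auto simp: complete_bipartite_edges_def finite_image_set2)
    moreover have "card E = 0" using False assms(3) by linarith
    ultimately have empty: "sym_diff E (complete_bipartite_edges {} {}) = {}"
      by (simp add: complete_bipartite_edges_def)
    have "real (card (sym_diff E (complete_bipartite_edges {} {}))) \<le> 3 * (real m - lam\<^sup>2)"
      unfolding empty using lam by simp
    with False show ?thesis by blast
  qed
qed

end
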